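(* For all integers $l>1$ and $k>1$ there exists an integer $N$ such that every finite word of length $N$ (over any alphabet) has a factor which is an $l$-power or a factor which is a $k$-anti-power. Moreover, letting $N(l,k)$ denote the least such integer, for every $k>2$ one has \[k^2-1\leq N(k,k)\leq k^3\binom{k}{2}.\]
   Context: An $l$-power is a word $u^l$ (concatenation of $l$ copies) with $u$ non-empty. A $k$-anti-power is a word $u_1\cdots u_k$ with $u_1,\ldots,u_k$ non-empty words of the same length that are pairwise distinct. A factor of a word is a block of consecutive letters. *)

theory Defs
  imports "HOL-Library.Sublist"
begin

definition is_power :: "nat \<Rightarrow> 'a list \<Rightarrow> bool" where
  "is_power l w \<longleftrightarrow> (\<exists>u. u \<noteq> [] \<and> w = concat (replicate l u))"

definition is_antipower :: "nat \<Rightarrow> 'a list \<Rightarrow> bool" where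
  "is_antipower k w \<longleftrightarrow>
     (\<exists>us m. length us = k \<and> (\<forall>u\<in>set us. u \<noteq> [] \<and> length u = m) \<and> distinct us \<and> w = concat us)"

definition unavoidable_length :: "'a itself \<Rightarrow> nat \<Rightarrow> nat \<Rightarrow> nat \<Rightarrow> bool" where
  "unavoidable_length (_ :: 'a itself) l k N \<longleftrightarrow>
     (\<forall>w :: 'a list. length w = N \<longrightarrow>
        (\<exists>v. sublist v w \<and> is_power l v) \<or> (\<exists>v. sublist v w \<and> is_antipower k v))"

text \<open>
  Alphabets are types, which cannot be quantified inside a formula. A finite word uses only
  finitely many letters, so a length that is unavoidable over the infinite alphabet
  \<^typ>\<open>nat\<close> is unavoidable over every alphabet; this is the lemma below. Hence the least length
  that is unavoidable over all alphabets simultaneously is the least one for \<^typ>\<open>nat\<close>.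
\<close>

definition N_min :: "nat \<Rightarrow> nat \<Rightarrow> nat" where
  "N_min l k = (LEAST N. unavoidable_length TYPE(nat) l k N)"

lemma unavoidable_length_any_alphabet:
  assumes "unavoidable_length TYPE(nat) l k N"
  shows "unavoidable_length TYPE('a) l k N"
  unfolding unavoidable_length_def
proof (intro allI impI)
  fix w :: "'a list"
  assume len: "length w = N"
  obtain f :: "'a \<Rightarrow> nat" where f: "inj_on f (set w)"
    using finite_imp_inj_to_nat_seg[of "set w"] by auto
  define g where "g = inv_into (set w) f"
  have gf: "g (f x) = x" if "x \<in> set w" for x
    using that f by (simp add: g_def)
  have gfw: "map g (map f w) = w"
    using gf by (simp add: map_idI)
  have inj: "inj_on g (set (map f w))"
    by (simp add: g_def inj_on_inv_into)
  have sub: "sublist (map g v) w" if "sublist v (map f w)" for v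
    using map_mono_sublist[OF that, of g] gfw by simp
  have pow: "is_power l (map g v)" if "is_power l v" for v
    using that unfolding is_power_def
    by (metis Nil_is_map_conv map_concat map_replicate)
  have anti: "is_antipower k (map g v)" if s: "sublist v (map f w)" and a: "is_antipower k v" for v
  proof -
    obtain us m where us: "length us = k" "\<forall>u\<in>set us. u \<noteq> [] \<and> length u = m" "distinct us"
        "v = concat us"
      using a unfolding is_antipower_def by blast
    have "set u \<subseteq> set (map f w)" if "u \<in> set us" for u
      using that us(4) set_mono_sublist[OF s] by auto
    then have "inj_on (map g) (set us)"
      by (intro inj_onI) (meson inj inj_on_map_eq_map inj_on_subset le_sup_iff)
    then have "distinct (map (map g) us)"
      using us(3) by (simp add: distinct_map)
    moreover have "map g v = concat (map (map g) us)"
      by (simp add: us(4) map_concat)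
    ultimately show ?thesis
      unfolding is_antipower_def using us(1,2)
      by (intro exI[of _ "map (map g) us"] exI[of _ m]) auto
  qed
  have "length (map f w) = N" using len by simp
  then have "(\<exists>v. sublist v (map f w) \<and> is_power l v) \<or>
      (\<exists>v. sublist v (map f w) \<and> is_antipower k v)"
    using assms unfolding unavoidable_length_def by blast
  then show "(\<exists>v. sublist v w \<and> is_power l v) \<or> (\<exists>v. sublist v w \<and> is_antipower k v)"
    by (blast intro: sub pow anti)
qed

end

(* Upper bound: cut a prefix of the word into k blocks of length m. Without a k-anti-power, two
   blocks, with indices i < j, agree. Letting m range over more than (k choose 2) consecutive
   values, two lengths m < m + d share the pair (i, j). The two resulting shifts by (j - i) * m and
   by (j - i) * (m + d) compose to the short period (j - i) * d on a long stretch, which gives an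
   l-power once m is large compared with d.

   Lower bound: the binary word 0^(k-1) 1 0^(k-2) 1 (0^(k-1) 1)^(k-3) 0^(k-1) of length k^2 - 2
   works. A block of length m < k contains at most one letter 1, so there are only m + 1 different
   blocks; for m = k - 1 the two ones at distance k - 1 create two equal blocks. *)

theory Submission
  imports Defs
begin

section \<open>Blocks and periods\<close>

lemma length_concat_uniform:
  assumes "\<And>u. u \<in> set us \<Longrightarrow> length u = m"
  shows "length (concat us) = length us * m"
  using assms by (induction us) auto

lemma nth_concat_uniform:
  assumes "\<And>u. u \<in> set us \<Longrightarrow> length u = m" and "i < length us" and "r < m"
  shows "concat us ! (i * m + r) = us ! i ! r"
  using assms
proof (induction us arbitrary: i)
  case (Cons u us)
  then show ?case
    by (cases i) (auto simp: nth_append)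
qed simp

lemma concat_blocks:
  "k * m \<le> length w \<Longrightarrow> concat (map (\<lambda>i. take m (drop (i * m) w)) [0..<k]) = take (k * m) w"
proof (induction k)
  case (Suc k)
  have "take (Suc k * m) w = take (k * m) w @ take m (drop (k * m) w)"
    by (metis add.commute mult_Suc take_add)
  then show ?case
    using Suc by simp
qed simp

text \<open>Period \<open>p\<close> moves every position back to its residue modulo
  \<open>p\<close>, so \<open>v\<close> repeats its prefix of length \<open>p\<close>. This lets
  powers be handled through index shifts alone.\<close>

lemma is_power_if_period:
  assumes "length v = l * p" and "0 < p"
    and "\<And>x. x + p < l * p \<Longrightarrow> v ! x = v ! (x + p)"
  shows "is_power l v"
proof -
  have periodic: "v ! (q * p + r) = v ! r" if "q * p + r < l * p" for q r
    using that
  proof (induction q)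
    case (Suc q)
    then have "v ! (q * p + r) = v ! (q * p + r + p)"
      by (intro assms(3)) (simp add: algebra_simps)
    with Suc show ?case
      by (simp add: algebra_simps)
  qed simp
  have "v = concat (replicate l (take p v))"
  proof (rule nth_equalityI)
    have len: "length (take p v) = p" if "0 < l"
      using that assms(1) by (cases l) auto
    show "length v = length (concat (replicate l (take p v)))"
      using assms(1) len by (subst length_concat_uniform[where m = p]) (auto split: if_splits)
    fix x assume "x < length v"
    then have x: "x < l * p" and l: "0 < l"
      using assms(1) by (auto intro: Nat.gr0I)
    have q: "x div p < l" and r: "x mod p < p"
      using x assms(2) by (auto simp: less_mult_imp_div_less)
    have "concat (replicate l (take p v)) ! (x div p * p + x mod p) = v ! (x mod p)"
      using q r len[OF l] by (subst nth_concat_uniform) auto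
    moreover have "v ! (x div p * p + x mod p) = v ! (x mod p)"
      using x by (intro periodic) simp
    ultimately show "v ! x = concat (replicate l (take p v)) ! x"
      by simp
  qed
  moreover have "take p v \<noteq> []" if "0 < l"
    using that assms(1,2) by auto
  \<comment> \<open>Here \<open>v\<close> is empty and so is its prefix, which cannot serve as the
    base; any non-empty word can.\<close>
  moreover have "is_power 0 v" if "l = 0"
    unfolding is_power_def using that assms(1) by (intro exI[of _ "[undefined]"]) simp
  ultimately show ?thesis
    unfolding is_power_def by blast
qed

lemma is_powerE:
  assumes "is_power l v"
  obtains p where "0 < p" and "length v = l * p"
    and "\<And>x. x + p < l * p \<Longrightarrow> v ! x = v ! (x + p)"
proof -
  obtain u where u: "u \<noteq> []" "v = concat (replicate l u)"
    using assms unfolding is_power_def by blast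
  define p where "p = length u"
  have p: "0 < p"
    using u(1) by (simp add: p_def)
  have nth: "v ! (q * p + r) = u ! r" if "q < l" "r < p" for q r
    unfolding u(2) using that by (subst nth_concat_uniform) (auto simp: p_def)
  have "v ! x = v ! (x + p)" if "x + p < l * p" for x
  proof -
    have "Suc (x div p) < l" "x div p < l"
      using less_mult_imp_div_less[OF that] p by (simp_all add: div_add_self2)
    then have "v ! (x div p * p + x mod p) = v ! (Suc (x div p) * p + x mod p)"
      using p by (simp only: nth mod_less_divisor)
    moreover have "Suc (x div p) * p + x mod p = x + p"
      by (simp add: algebra_simps)
    ultimately show ?thesis
      by simp
  qed
  moreover have "length v = l * p"
    unfolding u(2) p_def by (subst length_concat_uniform[where m = "length u"]) auto
  ultimately show thesis
    using that p by blast
qed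

lemma nth_sublist:
  assumes "sublist v w"
  obtains s where "s + length v \<le> length w" and "\<And>x. x < length v \<Longrightarrow> v ! x = w ! (s + x)"
proof -
  obtain ps ss where "w = ps @ v @ ss"
    using assms unfolding sublist_def by blast
  then show thesis
    by (intro that[of "length ps"]) (auto simp: nth_append)
qed

lemma sublist_take_drop: "sublist (take n (drop s w)) w"
  by (metis sublist_drop sublist_order.order_trans sublist_take)

section \<open>The upper bound\<close>

text \<open>The first \<open>k\<close> blocks of length \<open>m\<close> form a prefix of
  \<open>w\<close>. They have equal positive length, so only a repetition among them can keep this
  prefix from being a \<open>k\<close>-anti-power.\<close>

lemma equal_blocks_if_no_antipower:
  assumes "\<nexists>v. sublist v w \<and> is_antipower k v" and "0 < m" and "k * m \<le> length w"
  obtains i j where "i < j" and "j < k" and "\<And>x. x < m \<Longrightarrow> w ! (i * m + x) = w ! (j * m + x)"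
proof -
  define b where "b = (\<lambda>i. take m (drop (i * m) w))"
  have fit: "i * m + m \<le> length w" if "i < k" for i
  proof -
    have "Suc i * m \<le> k * m"
      using that by (intro mult_le_mono1) simp
    then show ?thesis
      using assms(3) by simp
  qed
  then have len: "length (b i) = m" if "i < k" for i
    using that[THEN fit] by (simp add: b_def)
  have "\<not> is_antipower k (take (k * m) w)"
    using assms(1) sublist_take by blast
  moreover have "b i \<noteq> []" if "i < k" for i
    using len[OF that] \<open>0 < m\<close> by auto
  moreover have "take (k * m) w = concat (map b [0..<k])"
    using concat_blocks[OF assms(3)] by (simp add: b_def)
  ultimately have "\<not> distinct (map b [0..<k])"
    unfolding is_antipower_def using len
    by (auto dest!: spec[of _ "map b [0..<k]"])
  then obtain i j where ij: "i < k" "j < k" "i \<noteq> j" "b i = b j"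
    by (auto simp: distinct_conv_nth)
  have "w ! (i * m + x) = w ! (j * m + x)" if "x < m" for x
  proof -
    have "w ! (n * m + x) = b n ! x" if "n < k" for n
      using fit[OF that] \<open>x < m\<close> by (simp add: b_def)
    then show ?thesis
      using ij by simp
  qed
  with ij show thesis
    using that[of i j] that[of j i] by (cases "i < j") auto
qed

text \<open>Going back by \<open>e * m\<close> and forward by \<open>e * (m + d)\<close> is a net
  shift by \<open>e * d\<close>. The two moves fit together because offset \<open>i * d + z\<close>
  in block \<open>i\<close> of length \<open>m\<close> is offset \<open>z\<close> in block
  \<open>i\<close> of length \<open>m + d\<close>.\<close>

lemma power_from_two_block_lengths:
  fixes w :: "'a list"
  assumes "0 < d" and "0 < e" and "0 < l"
    and "\<And>x. x < m \<Longrightarrow> w ! (i * m + x) = w ! ((i + e) * m + x)"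
    and "\<And>x. x < m + d \<Longrightarrow> w ! (i * (m + d) + x) = w ! ((i + e) * (m + d) + x)"
    and bound: "i * d + (l - 1) * (e * d) \<le> m"
    and len: "(i + e + 1) * (m + d) \<le> length w"
  shows "\<exists>v. sublist v w \<and> is_power l v"
proof -
  \<comment> \<open>Going back by \<open>e * m\<close> from \<open>t\<close> leads exactly to the
    start of block \<open>i\<close> of length \<open>m + d\<close>.\<close>
  define t where "t = (i + e) * m + i * d"
  define p where "p = e * d"
  have lp: "l * p = (l - 1) * p + p"
    using \<open>0 < l\<close> by (cases l) auto
  have shift: "w ! (t + z) = w ! (t + z + p)" if "z + p < l * p" for z
  proof -
    have z: "i * d + z < m"
      using that bound lp by (simp add: p_def)
    have "w ! (t + z) = w ! ((i + e) * m + (i * d + z))"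
      by (simp add: t_def algebra_simps)
    also have "\<dots> = w ! (i * m + (i * d + z))"
      using assms(4) z by simp
    also have "\<dots> = w ! (i * (m + d) + z)"
      by (simp add: algebra_simps)
    also have "\<dots> = w ! ((i + e) * (m + d) + z)"
      using assms(5) z by simp
    also have "\<dots> = w ! (t + z + p)"
      by (simp add: t_def p_def algebra_simps)
    finally show ?thesis .
  qed
  \<comment> \<open>One period after \<open>t\<close> block \<open>i + e\<close> of length
    \<open>m + d\<close> begins; the other \<open>l - 1\<close> periods fit into it by
    \<open>bound\<close>.\<close>
  have "t + l * p = (i + e) * (m + d) + (l - 1) * p"
    unfolding lp by (simp add: t_def p_def algebra_simps)
  also have "\<dots> \<le> (i + e + 1) * (m + d)"
    using bound by (simp add: p_def)
  finally have fit: "t + l * p \<le> length w"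
    using len by simp
  have "is_power l (take (l * p) (drop t w))"
  proof (rule is_power_if_period)
    show "length (take (l * p) (drop t w)) = l * p"
      using fit by simp
    show "0 < p"
      using assms by (simp add: p_def)
    fix x assume x: "x + p < l * p"
    then show "take (l * p) (drop t w) ! x = take (l * p) (drop t w) ! (x + p)"
      using shift[OF x] fit by (simp add: add.assoc)
  qed
  then show ?thesis
    using sublist_take_drop by blast
qed

lemma power_or_antipower:
  fixes w :: "'a list"
  assumes "1 < l" and "1 < k"
    and len: "k * (((l - 1) * (k - 1) + 1) * (k choose 2)) \<le> length w"
  shows "(\<exists>v. sublist v w \<and> is_power l v) \<or> (\<exists>v. sublist v w \<and> is_antipower k v)"
proof (rule disjCI)
  assume no_antipower: "\<nexists>v. sublist v w \<and> is_antipower k v"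
  define c where "c = k choose 2"
  \<comment> \<open>Two lengths in \<open>{m0..m0 + c}\<close> differ by at most \<open>c\<close>,
    and this start is large enough for the bound on \<open>i * d + (l - 1) * (e * d)\<close> below.
    The largest length \<open>m0 + c\<close> uses up the assumed length of \<open>w\<close>.\<close>
  define m0 where "m0 = (l - 1) * (k - 1) * c"
  have "0 < c"
    using \<open>1 < k\<close> by (simp add: c_def zero_less_binomial)
  then have "0 < m0"
    using assms by (simp add: m0_def)
  have fit: "k * m \<le> length w" if "m \<le> m0 + c" for m
  proof -
    have "k * m \<le> k * (m0 + c)"
      using that by simp
    also have "\<dots> = k * (((l - 1) * (k - 1) + 1) * (k choose 2))"
      by (simp add: m0_def c_def algebra_simps)
    finally show ?thesis
      using len by (rule order.trans)
  qed
  define blocks_eq where "blocks_eq m i j \<longleftrightarrow> i < j \<and> j < k \<and>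
    (\<forall>x<m. w ! (i * m + x) = w ! (j * m + x))" for m i j
  have "\<exists>i j. blocks_eq m i j" if "m \<in> {m0..m0 + c}" for m
    using equal_blocks_if_no_antipower[OF no_antipower, of m] fit[of m] that \<open>0 < m0\<close>
    unfolding blocks_eq_def by (metis atLeastAtMost_iff le_less_trans less_le_trans)
  then obtain f g where fg: "\<And>m. m \<in> {m0..m0 + c} \<Longrightarrow> blocks_eq m (f m) (g m)"
    by metis
  \<comment> \<open>There are \<open>c + 1\<close> lengths but only \<open>c\<close> two-element
    subsets of \<open>{..<k}\<close>. The set loses no information, since \<open>f m < g m\<close>
    restores the order.\<close>
  define h where "h m = {f m, g m}" for m
  have "h ` {m0..m0 + c} \<subseteq> {A. A \<subseteq> {..<k} \<and> card A = 2}"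
    using fg by (fastforce simp: h_def blocks_eq_def card_2_iff)
  then have "card (h ` {m0..m0 + c}) \<le> card {A. A \<subseteq> {..<k} \<and> card A = 2}"
    by (intro card_mono) auto
  also have "\<dots> = c"
    by (simp add: n_subsets c_def)
  finally have "\<not> inj_on h {m0..m0 + c}"
    by (intro pigeonhole) simp
  then obtain m m' where mm: "m \<in> {m0..m0 + c}" "m' \<in> {m0..m0 + c}" "m < m'" "h m = h m'"
    unfolding inj_on_def by (metis linorder_neqE_nat)
  define i where "i = f m"
  define j where "j = g m"
  have "f m' = i" "g m' = j"
    using fg[OF mm(1)] fg[OF mm(2)] mm(4)
    by (auto simp: h_def i_def j_def blocks_eq_def doubleton_eq_iff)
  with fg[OF mm(1)] fg[OF mm(2)] have eq: "blocks_eq m i j" "blocks_eq m' i j"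
    by (auto simp: i_def j_def)
  then have "i < j" "j < k"
    by (auto simp: blocks_eq_def)
  then obtain e where e: "j = i + e" "0 < e"
    using less_imp_add_positive by blast
  obtain d where d: "m' = m + d" "0 < d"
    using mm(3) less_imp_add_positive by blast
  have "d \<le> c"
    using mm d by auto
  have "i + (l - 1) * e \<le> (l - 1) * (i + e)"
    using \<open>1 < l\<close> by (auto simp: add_mult_distrib2)
  also have "\<dots> \<le> (l - 1) * (k - 1)"
    using \<open>j < k\<close> e by (intro mult_le_mono2) simp
  finally have "(i + (l - 1) * e) * d \<le> m0"
    unfolding m0_def using \<open>d \<le> c\<close> by (rule mult_le_mono)
  then have bound: "i * d + (l - 1) * (e * d) \<le> m"
    using mm(1) by (simp add: algebra_simps)
  have "(i + e + 1) * (m + d) \<le> k * m'"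
    unfolding d(1) using \<open>j < k\<close> e by (intro mult_le_mono1) simp
  also have "\<dots> \<le> length w"
    using mm(2) by (intro fit) simp
  finally show "\<exists>v. sublist v w \<and> is_power l v"
    using eq d e \<open>1 < l\<close> bound
    by (intro power_from_two_block_lengths[of d e l m w i]) (auto simp: blocks_eq_def)
qed

section \<open>The lower bound\<close>

(* The set of positions of the letter 1: k - 1, 2 k - 2, 3 k - 2, 4 k - 2, ... *)
definition one_at :: "nat \<Rightarrow> nat \<Rightarrow> bool" where
  "one_at k i \<longleftrightarrow> i = k - 1 \<or> k \<le> i \<and> k dvd i + 2"

text \<open>From the second one on, positions differ by multiples of \<open>k\<close>; only the
  first gap, from \<open>k - 1\<close> to \<open>2 * k - 2\<close>, is shorter.\<close>

lemma one_at_gap: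
  assumes "2 < k" and "one_at k i" and "one_at k j" and "i < j"
  shows "k - 1 \<le> j - i"
proof -
  have j: "k \<le> j" "k dvd j + 2"
    using assms by (auto simp: one_at_def)
  show ?thesis
  proof (cases "i = k - 1")
    case True
    have "k dvd j + 2 - k"
      using j by (simp add: dvd_diff_nat)
    then have "k \<le> j + 2 - k"
      using j(1) by (intro dvd_imp_le) auto
    then show ?thesis
      using True assms(1) by simp
  next
    case False
    then have "k dvd (j + 2) - (i + 2)"
      using assms(2) j by (intro dvd_diff_nat) (auto simp: one_at_def)
    then show ?thesis
      using \<open>i < j\<close> by (auto dest: dvd_imp_le)
  qed
qed

lemma one_at_first_two:
  assumes "2 < k"
  shows "one_at k (k - 1)" and "one_at k (2 * (k - 1))"
proof -
  have "2 * (k - 1) + 2 = 2 * k" "k \<le> 2 * (k - 1)"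
    using assms by auto
  then show "one_at k (2 * (k - 1))"
    unfolding one_at_def by (metis dvd_triv_right)
qed (simp add: one_at_def)

text \<open>No gap exceeds \<open>k\<close>, and the first one is at \<open>k - 1\<close>. For
  \<open>s\<close> at least \<open>k\<close>, the witness solves \<open>s + x + 2\<close> congruent
  to 0 modulo \<open>k\<close>.\<close>

lemma one_at_in_window:
  assumes "2 < k"
  obtains x where "x < k" and "one_at k (s + x)"
proof (cases "s < k")
  case True
  then show thesis
    by (intro that[of "k - 1 - s"]) (auto simp: one_at_def)
next
  case False
  define x where "x = (k - 1) - (s + 1) mod k"
  have r: "(s + 1) mod k \<le> k - 1"
    using assms by (metis Suc_pred' less_Suc_eq_le mod_less_divisor not_less_zero neq0_conv)
  have "s + x + 2 = (s + 1) - (s + 1) mod k + k"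
    using r mod_less_eq_dividend[of "s + 1" k] assms by (simp add: x_def)
  then have "k dvd s + x + 2"
    by (simp only: dvd_add_left_iff dvd_refl dvd_minus_mod)
  with False assms show thesis
    by (intro that[of x]) (auto simp: one_at_def x_def)
qed

text \<open>The length is a parameter because bounding a least element from below requires a
  counterexample at every smaller length.\<close>

definition lower_word :: "nat \<Rightarrow> nat \<Rightarrow> nat list" where
  "lower_word k n = map (\<lambda>i. of_bool (one_at k i)) [0..<n]"

text \<open>A period below \<open>k - 1\<close> would put two ones too close together. Period
  \<open>k - 1\<close> is ruled out by one misplaced letter: near the start of the word the gaps
  change from \<open>k - 1\<close> to \<open>k\<close>.\<close>

lemma lower_word_no_power:
  assumes k: "2 < k" and n: "n < k\<^sup>2 - 1" and sub: "sublist v (lower_word k n)"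
  shows "\<not> is_power k v"
proof
  assume "is_power k v"
  then obtain m where m: "0 < m" "length v = k * m"
    and per: "\<And>x. x + m < k * m \<Longrightarrow> v ! x = v ! (x + m)"
    by (elim is_powerE) blast
  obtain s where s: "s + k * m \<le> n" and v: "\<And>x. x < k * m \<Longrightarrow> v ! x = lower_word k n ! (s + x)"
    using nth_sublist[OF sub] m(2) by (metis length_map length_upt lower_word_def diff_zero)
  have shift: "one_at k (s + x) \<longleftrightarrow> one_at k (s + x + m)" if "x + m < k * m" for x
  proof -
    have "lower_word k n ! (s + x) = lower_word k n ! (s + x + m)"
      using per[OF that] v[of x] v[of "x + m"] that by (simp add: add.assoc)
    then show ?thesis
      using that s by (simp add: lower_word_def of_bool_eq_iff)
  qed
  have km: "3 * m \<le> k * m"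
    using k by (intro mult_le_mono1) simp
  have sq: "k\<^sup>2 = k * (k - 1) + k"
    using k by (simp add: power2_eq_square algebra_simps)
  have "k * m < k * k"
    using s n unfolding power2_eq_square by linarith
  then have "m \<le> k - 1"
    by auto
  then consider "m < k - 1" | "m = k - 1"
    by linarith
  then show False
  proof cases
    case 1
    obtain x where x: "x < k" "one_at k (s + x)"
      using one_at_in_window[OF k] .
    have "k \<le> k * m"
      using m(1) by simp
    show False
    proof (cases "x + m < k * m")
      case True
      then show False
        using shift[OF True] x one_at_gap[OF k, of "s + x" "s + x + m"] 1 m(1) by simp
    next
      case False
      \<comment> \<open>Too close to the right end, the one is shifted to the left instead; at least
        three periods leave room for this.\<close>
      then have "m \<le> x"
        using km by linarith
      moreover from this have "one_at k (s + (x - m))"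
        using shift[of "x - m"] x \<open>k \<le> k * m\<close> by simp
      ultimately show False
        using x one_at_gap[OF k, of "s + (x - m)" "s + x"] 1 m(1) by simp
    qed
  next
    case 2
    have sle: "s + 1 < k"
      using s n sq 2 by simp
    show False
    proof (cases "s = 0")
      case True
      have "one_at k 0"
        using shift[of 0] one_at_first_two(1)[OF k] 2 True km k by simp
      then show False
        using k by (simp add: one_at_def)
    next
      case False
      \<comment> \<open>The one at \<open>2 * (k - 1)\<close> would recur at
        \<open>3 * (k - 1)\<close>, just before the third one. For \<open>k = 3\<close> this target
        lies inside the factor only because \<open>s > 0\<close>.\<close>
      have eqs: "s + (2 * (k - 1) - s) = 2 * (k - 1)" "2 * (k - 1) + m = 3 * (k - 1)"
        using sle 2 by simp_all
      have "2 * (k - 1) - s + m < k * m"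
        using 2 sle km False by linarith
      then have "one_at k (3 * (k - 1))"
        using shift one_at_first_two(2)[OF k] eqs by metis
      then have "k dvd 3 * (k - 1) + 2"
        using k by (auto simp: one_at_def)
      moreover have "3 * (k - 1) + 2 = 2 * k + (k - 1)"
        using k by simp
      ultimately have "k dvd k - 1"
        by (simp only: dvd_add_right_iff dvd_triv_right)
      then show False
        using k by (auto dest: dvd_imp_le)
    qed
  qed
qed

text \<open>Each block holds at most one letter 1, so its offset, or its absence, determines the
  block: \<open>m + 1\<close> possibilities. This is fewer than \<open>k\<close> unless
  \<open>m = k - 1\<close>, where the first two ones, at distance \<open>m\<close>, have the same
  offset in adjacent blocks.\<close>

lemma lower_word_no_antipower:
  assumes k: "2 < k" and n: "n < k\<^sup>2 - 1" and sub: "sublist v (lower_word k n)"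
  shows "\<not> is_antipower k v"
proof
  assume "is_antipower k v"
  then obtain us m where us: "length us = k" "\<And>u. u \<in> set us \<Longrightarrow> length u = m"
      "[] \<notin> set us" "distinct us" "v = concat us"
    unfolding is_antipower_def by blast
  have len: "length v = k * m"
    using us by (simp add: length_concat_uniform)
  obtain s where s: "s + k * m \<le> n" and v: "\<And>x. x < k * m \<Longrightarrow> v ! x = lower_word k n ! (s + x)"
    using nth_sublist[OF sub] len by (metis length_map length_upt lower_word_def diff_zero)
  have in_range: "i * m + r < k * m" if "i < k" "r < m" for i r
  proof -
    have "Suc i * m \<le> k * m"
      using that by (intro mult_le_mono1) simp
    then show ?thesis
      using that by simp
  qed
  have block: "us ! i ! r = of_bool (one_at k (s + i * m + r))" if "i < k" "r < m" for i r
    using nth_concat_uniform[where us = us and i = i and r = r, OF us(2)] us v[OF in_range[OF that]] s in_range[OF that] that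
    by (simp add: lower_word_def add.assoc)
  have block_eq: "us ! i = us ! j"
    if "i < k" "j < k" "\<And>r. r < m \<Longrightarrow> one_at k (s + i * m + r) \<longleftrightarrow> one_at k (s + j * m + r)" for i j
    using that us by (intro nth_equalityI) (auto simp: block)
  have "k * m < k * k"
    using s n unfolding power2_eq_square by linarith
  then have "m \<le> k - 1"
    by auto
  have same_block_eq: "r = r'"
    if "one_at k (t + r)" "one_at k (t + r')" "r < m" "r' < m" for t r r'
    using that one_at_gap[OF k, of "t + r" "t + r'"] one_at_gap[OF k, of "t + r'" "t + r"] \<open>m \<le> k - 1\<close>
    by (cases r r' rule: linorder_cases) auto
  have eq_if_common: "us ! i = us ! j"
    if "i < k" "j < k" "r < m" "one_at k (s + i * m + r)" "one_at k (s + j * m + r)" for i j r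
    using that same_block_eq by (intro block_eq) blast+
  from \<open>m \<le> k - 1\<close> consider "m < k - 1" | "m = k - 1"
    by linarith
  then show False
  proof cases
    case 1
    \<comment> \<open>The value \<open>m\<close>, not an offset in a block, encodes a block of
      zeros.\<close>
    define f where "f i = (if \<exists>r<m. one_at k (s + i * m + r)
      then SOME r. r < m \<and> one_at k (s + i * m + r) else m)" for i
    have f: "f i < m \<and> one_at k (s + i * m + f i) \<or>
        f i = m \<and> (\<forall>r<m. \<not> one_at k (s + i * m + r))" for i
      unfolding f_def by (auto intro: someI2)
    have "f i \<le> m" for i
      using f[of i] by auto
    then have "f ` {..<k} \<subseteq> {..m}"
      by auto
    then have "card (f ` {..<k}) \<le> card {..m}"
      by (intro card_mono) auto
    also have "\<dots> < card {..<k}"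
      using 1 by simp
    finally obtain i j where ij: "i < k" "j < k" "i \<noteq> j" "f i = f j"
      using pigeonhole[of f "{..<k}"] by (auto simp: inj_on_def)
    have "us ! i = us ! j"
      using f[of i] f[of j] ij by (metis block_eq eq_if_common less_irrefl)
    then show False
      using ij us(1,4) by (simp add: nth_eq_iff_index_eq)
  next
    case 2
    have "k\<^sup>2 = k * (k - 1) + k"
      using k by (simp add: power2_eq_square algebra_simps)
    then have sle: "s + 1 < k"
      using s n 2 by simp
    define r where "r = k - 1 - s"
    \<comment> \<open>For \<open>s = 0\<close> the first one sits just past block 0, at offset 0 of
      block 1; otherwise it lies inside block 0, at offset \<open>r\<close>.\<close>
    define i :: nat where "i = (if s = 0 then 1 else 0)"
    define q where "q = (if s = 0 then 0 else r)"
    have "us ! i = us ! Suc i"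
    proof (rule eq_if_common)
      show "i < k" "Suc i < k" "q < m"
        using k sle 2 by (auto simp: i_def q_def r_def)
      have "s + i * m + q = k - 1" "s + Suc i * m + q = 2 * (k - 1)"
        using sle 2 by (auto simp: i_def q_def r_def)
      then show "one_at k (s + i * m + q)" "one_at k (s + Suc i * m + q)"
        using one_at_first_two[OF k] by simp_all
    qed
    moreover have "i < k" "Suc i < k"
      using k by (auto simp: i_def)
    ultimately show False
      using us(1,4) by (simp add: nth_eq_iff_index_eq)
  qed
qed

section \<open>Bounds on the least unavoidable length\<close>

lemma not_unavoidable_length_below:
  assumes "2 < k" and "n < k\<^sup>2 - 1"
  shows "\<not> unavoidable_length TYPE(nat) k k n"
  using lower_word_no_power[OF assms] lower_word_no_antipower[OF assms]
  unfolding unavoidable_length_def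
  by (metis diff_zero length_map length_upt lower_word_def)

theorem theorem14:
  shows "(\<forall>l>1. \<forall>k>1. (\<exists>N. unavoidable_length TYPE(nat) l k N) \<and>
            unavoidable_length TYPE('a) l k (N_min l k)) \<and>
         (\<forall>k>2. k\<^sup>2 - 1 \<le> N_min k k \<and> N_min k k \<le> k ^ 3 * (k choose 2))"
proof -
  have unavoidable: "unavoidable_length TYPE(nat) l k N"
    if "1 < l" "1 < k" "k * (((l - 1) * (k - 1) + 1) * (k choose 2)) \<le> N" for l k N
    using power_or_antipower[OF that(1,2)] that(3) unfolding unavoidable_length_def by blast
  have minimal: "unavoidable_length TYPE(nat) l k (N_min l k)" if "1 < l" "1 < k" for l k
    unfolding N_min_def using unavoidable[OF that order_refl] by (rule LeastI)
  have lower: "k\<^sup>2 - 1 \<le> N_min k k" if "2 < k" for k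
    using not_unavoidable_length_below[OF that] minimal[of k k] that
    by (metis less_trans not_le one_less_numeral_iff semiring_norm(76))
  have upper: "N_min k k \<le> k ^ 3 * (k choose 2)" if "2 < k" for k
    unfolding N_min_def
  proof (intro Least_le unavoidable)
    \<comment> \<open>For \<open>l = k\<close> the sharper factor
      \<open>(k - 1) * (k - 1) + 1\<close> is relaxed to \<open>k * k\<close>, which gives the cubic
      form.\<close>
    have "(k - 1) * (k - 1) + 1 \<le> (k - 1) * k + k"
      using that by (intro add_mono mult_le_mono2) auto
    also have "\<dots> = k * k"
      using that by (cases k) auto
    finally have "k * (((k - 1) * (k - 1) + 1) * (k choose 2)) \<le> k * (k * k * (k choose 2))"
      by (intro mult_le_mono2 mult_le_mono1)
    then show "k * (((k - 1) * (k - 1) + 1) * (k choose 2)) \<le> k ^ 3 * (k choose 2)"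
      by (simp add: power3_eq_cube mult.assoc)
  qed (use that in auto)
  show ?thesis
    using unavoidable minimal lower upper by (blast intro: unavoidable_length_any_alphabet)
qed

end
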